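(* Let $X$ be a topological lop (with regular underlying space) that contains an open sublop $H$ which is a cosmic space. Then $X$ admits a cover by pairwise disjoint open sets that refines the open cover $\{xH:x\in X\}$ of $X$, where $xH=\{xh:h\in H\}$. Consequently, $X$ is a topological sum of cosmic subspaces, and hence $X$ is submetrizable and strongly paracompact.
   Context: All topological spaces are assumed to be regular (including the $T_1$ axiom). A topological lop is a topological space $X$ endowed with a continuous binary operation $X\times X\to X$, $(x,y)\mapsto xy$, which has a two-sided unit $e$ (so $xe=x=ex$ for all $x\in X$) and for which the map $X\times X\to X\times X$, $(x,y)\mapsto(x,xy)$, is a homeomorphism. The operation need not be associative. For $a,b\in X$, $a^{-1}b$ denotes the unique $x\in X$ with $ax=b$. A sublop of $X$ is a nonempty subset $A\subset X$ such that $ab\in A$ and $a^{-1}b\in A$ for all $a,b\in A$. A family $\mathcal N$ of subsets of a space $Y$ is a network if for each point $y\in Y$ and neighborhood $O_y$ of $y$ there is $N\in\mathcal N$ with $y\in N\subset O_y$. A regular space is cosmic if it has a countable network. A space $X$ is submetrizable if it admits a continuous metric, i.e. a metric $d:X\times X\to\mathbb R$ that is continuous with respect to the topology of $X$. A space is strongly paracompact if every open cover has a star-finite open refinement (each member of the refinement meets only finitely many other members). *)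

theory Defs
  imports "HOL-Analysis.Analysis"
begin

definition open_cover_of :: "'a topology \<Rightarrow> 'a set set \<Rightarrow> bool" where
  "open_cover_of X \<U> \<longleftrightarrow> (\<forall>U\<in>\<U>. openin X U) \<and> \<Union>\<U> = topspace X"

definition cover_refines :: "'a set set \<Rightarrow> 'a set set \<Rightarrow> bool" where
  "cover_refines \<V> \<U> \<longleftrightarrow> (\<forall>V\<in>\<V>. \<exists>U\<in>\<U>. V \<subseteq> U)"

definition star_finite :: "'a set set \<Rightarrow> bool" where
  "star_finite \<V> \<longleftrightarrow> (\<forall>V\<in>\<V>. finite {W\<in>\<V>. W \<inter> V \<noteq> {}})"

definition strongly_paracompact_space :: "'a topology \<Rightarrow> bool" where
  "strongly_paracompact_space X \<longleftrightarrow>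
     (\<forall>\<U>. open_cover_of X \<U> \<longrightarrow>
        (\<exists>\<V>. open_cover_of X \<V> \<and> cover_refines \<V> \<U> \<and> star_finite \<V>))"

definition submetrizable_space :: "'a topology \<Rightarrow> bool" where
  "submetrizable_space X \<longleftrightarrow>
     (\<exists>d. Metric_space (topspace X) d \<and>
          continuous_map (prod_topology X X) euclideanreal (\<lambda>(x, y). d x y))"

definition is_network :: "'a topology \<Rightarrow> 'a set set \<Rightarrow> bool" where
  "is_network Y \<N> \<longleftrightarrow>
     (\<forall>N\<in>\<N>. N \<subseteq> topspace Y) \<and>
     (\<forall>y\<in>topspace Y. \<forall>U. openin Y U \<and> y \<in> U \<longrightarrow> (\<exists>N\<in>\<N>. y \<in> N \<and> N \<subseteq> U))"

text \<open>The library's \<^const>\<open>regular_space\<close> does not include the \<open>T\<^sub>1\<close> axiom.\<close>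

definition regular_t1_space :: "'a topology \<Rightarrow> bool" where
  "regular_t1_space X \<longleftrightarrow> regular_space X \<and> t1_space X"

definition cosmic_space :: "'a topology \<Rightarrow> bool" where
  "cosmic_space Y \<longleftrightarrow> regular_t1_space Y \<and> (\<exists>\<N>. countable \<N> \<and> is_network Y \<N>)"

text \<open>The canonical map from the disjoint sum of the subspaces \<open>U \<in> \<U>\<close> to \<open>X\<close>, which on
  each summand is the inclusion, is \<^const>\<open>snd\<close>.\<close>

definition topological_sum_of_subspaces :: "'a topology \<Rightarrow> 'a set set \<Rightarrow> bool" where
  "topological_sum_of_subspaces X \<U> \<longleftrightarrow>
     (\<forall>U\<in>\<U>. U \<subseteq> topspace X) \<and>
     homeomorphic_map (sum_topology (\<lambda>U. subtopology X U) \<U>) X snd"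

text \<open>The operation is a total function on the type, of which only the values on
  \<^term>\<open>topspace X\<close> matter.\<close>

locale topological_lop =
  fixes X :: "'a topology" and mul :: "'a \<Rightarrow> 'a \<Rightarrow> 'a" and e :: 'a
  assumes continuous_mul: "continuous_map (prod_topology X X) X (\<lambda>(x, y). mul x y)"
    and unit_in: "e \<in> topspace X"
    and right_unit: "x \<in> topspace X \<Longrightarrow> mul x e = x"
    and left_unit: "x \<in> topspace X \<Longrightarrow> mul e x = x"
    and homeomorphic_shear:
      "homeomorphic_map (prod_topology X X) (prod_topology X X) (\<lambda>(x, y). (x, mul x y))"

definition left_div :: "'a topology \<Rightarrow> ('a \<Rightarrow> 'a \<Rightarrow> 'a) \<Rightarrow> 'a \<Rightarrow> 'a \<Rightarrow> 'a" where
  "left_div X mul a b = (THE x. x \<in> topspace X \<and> mul a x = b)"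

definition sublop :: "'a topology \<Rightarrow> ('a \<Rightarrow> 'a \<Rightarrow> 'a) \<Rightarrow> 'a set \<Rightarrow> bool" where
  "sublop X mul A \<longleftrightarrow>
     A \<noteq> {} \<and> A \<subseteq> topspace X \<and>
     (\<forall>a\<in>A. \<forall>b\<in>A. mul a b \<in> A \<and> left_div X mul a b \<in> A)"

end

theory Submission
  imports Defs
begin

text \<open>The translates \<open>xH\<close> are clopen but may overlap in a complicated way. A set \<open>S\<close> with
  \<open>SH \<subseteq> S\<close> is clopen, and this property passes to arbitrary unions. The smallest such set
  containing \<open>x\<close>, the union of \<open>{x}\<close>, \<open>xH\<close>, \<open>(xH)H\<close>, and so on, is cosmic. These hulls can
  therefore be disjointified along a well-order of \<open>X\<close>, since every initial union of hulls is
  closed. Each hull is Lindelof, hence covered by countably many clopen translates, which can be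
  disjointified too.

  On a cosmic piece, countably many Urysohn functions separate points; together with the index of
  the piece they map \<open>X\<close> injectively into the metrizable product of a discrete space and
  \<open>\<real>\<^sup>\<nat>\<close>.\<close>

subsection \<open>Countable networks\<close>

text \<open>The part of cosmicity that passes to continuous images. Regularity need not pass, so it
  is tracked separately.\<close>

definition has_countable_network :: "'a topology \<Rightarrow> bool" where
  "has_countable_network Y \<longleftrightarrow> (\<exists>\<N>. countable \<N> \<and> is_network Y \<N>)"

text \<open>Network members need not be open, so the images of a network form a network even when
  \<open>f\<close> is not an open map.\<close>

lemma has_countable_network_image:
  assumes "has_countable_network X" "continuous_map X Y f" "f ` topspace X = topspace Y"
  shows "has_countable_network Y"
proof -
  obtain \<N> where \<N>: "countable \<N>" "is_network X \<N>"
    using assms(1) unfolding has_countable_network_def by auto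
  have "is_network Y ((`) f ` \<N>)"
    unfolding is_network_def
  proof (intro conjI ballI allI impI)
    show "N \<subseteq> topspace Y" if "N \<in> (`) f ` \<N>" for N
      using that \<N>(2) assms(3) unfolding is_network_def by blast
    fix y U
    assume "y \<in> topspace Y" and U: "openin Y U \<and> y \<in> U"
    then obtain x where x: "x \<in> topspace X" "f x = y"
      using assms(3) by force
    have "openin X {x \<in> topspace X. f x \<in> U}"
      using U assms(2) openin_continuous_map_preimage by blast
    then obtain N where "N \<in> \<N>" "x \<in> N" "N \<subseteq> {x \<in> topspace X. f x \<in> U}"
      using \<N>(2) x U unfolding is_network_def by (metis (no_types, lifting) mem_Collect_eq)
    then show "\<exists>N\<in>(`) f ` \<N>. y \<in> N \<and> N \<subseteq> U"
      using x by blast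
  qed
  then show ?thesis
    using \<N>(1) unfolding has_countable_network_def by blast
qed

lemma has_countable_network_subtopology:
  assumes "has_countable_network X"
  shows "has_countable_network (subtopology X S)"
proof -
  obtain \<N> where \<N>: "countable \<N>" "is_network X \<N>"
    using assms unfolding has_countable_network_def by auto
  have "is_network (subtopology X S) ((\<inter>) S ` \<N>)"
    unfolding is_network_def
  proof (intro conjI ballI allI impI)
    show "N \<subseteq> topspace (subtopology X S)" if "N \<in> (\<inter>) S ` \<N>" for N
      using that \<N>(2) unfolding is_network_def by auto
    fix y U
    assume y: "y \<in> topspace (subtopology X S)" and U: "openin (subtopology X S) U \<and> y \<in> U"
    then obtain T where "openin X T" "U = T \<inter> S"
      by (auto simp: openin_subtopology)
    moreover obtain N where "N \<in> \<N>" "y \<in> N" "N \<subseteq> T"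
      using \<N>(2) y U calculation unfolding is_network_def by (metis IntD1 topspace_subtopology)
    ultimately show "\<exists>N\<in>(\<inter>) S ` \<N>. y \<in> N \<and> N \<subseteq> U"
      using y by auto
  qed
  then show ?thesis
    using \<N>(1) unfolding has_countable_network_def by blast
qed

lemma has_countable_network_prod:
  assumes "has_countable_network X" "has_countable_network Y"
  shows "has_countable_network (prod_topology X Y)"
proof -
  obtain \<M> \<N> where \<M>: "countable \<M>" "is_network X \<M>" and \<N>: "countable \<N>" "is_network Y \<N>"
    using assms unfolding has_countable_network_def by auto
  have "is_network (prod_topology X Y) ((\<lambda>(M, N). M \<times> N) ` (\<M> \<times> \<N>))"
    unfolding is_network_def
  proof (intro conjI ballI allI impI)
    show "P \<subseteq> topspace (prod_topology X Y)" if "P \<in> (\<lambda>(M, N). M \<times> N) ` (\<M> \<times> \<N>)" for P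
      using that \<M>(2) \<N>(2) unfolding is_network_def by fastforce
    fix p W
    assume "p \<in> topspace (prod_topology X Y)" and W: "openin (prod_topology X Y) W \<and> p \<in> W"
    then obtain x y where p: "p = (x, y)" "x \<in> topspace X" "y \<in> topspace Y"
      by auto
    then obtain U V where UV: "openin X U" "openin Y V" "x \<in> U" "y \<in> V" "U \<times> V \<subseteq> W"
      using W unfolding openin_prod_topology_alt by metis
    obtain M N where "M \<in> \<M>" "x \<in> M" "M \<subseteq> U" "N \<in> \<N>" "y \<in> N" "N \<subseteq> V"
      using \<M>(2) \<N>(2) p UV unfolding is_network_def by meson
    then have "M \<times> N \<in> (\<lambda>(M, N). M \<times> N) ` (\<M> \<times> \<N>)" "p \<in> M \<times> N" "M \<times> N \<subseteq> W"
      using p UV by auto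
    then show "\<exists>P\<in>(\<lambda>(M, N). M \<times> N) ` (\<M> \<times> \<N>). p \<in> P \<and> P \<subseteq> W"
      by blast
  qed
  moreover have "countable ((\<lambda>(M, N). M \<times> N) ` (\<M> \<times> \<N>))"
    using \<M>(1) \<N>(1) by simp
  ultimately show ?thesis
    unfolding has_countable_network_def by blast
qed

text \<open>The pieces \<open>S i\<close> may be arbitrary subsets: a network member of one piece
  inside \<open>T \<inter> S i\<close> also lies inside the trace of \<open>T\<close> on the
  union.\<close>

lemma has_countable_network_UN:
  assumes "countable I" "\<And>i. i \<in> I \<Longrightarrow> has_countable_network (subtopology X (S i))"
  shows "has_countable_network (subtopology X (\<Union>i\<in>I. S i))"
proof -
  obtain \<N> where \<N>: "\<And>i. i \<in> I \<Longrightarrow> countable (\<N> i)"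
      "\<And>i. i \<in> I \<Longrightarrow> is_network (subtopology X (S i)) (\<N> i)"
    using assms(2) unfolding has_countable_network_def by metis
  have "is_network (subtopology X (\<Union>i\<in>I. S i)) (\<Union>i\<in>I. \<N> i)"
    unfolding is_network_def
  proof (intro conjI ballI allI impI)
    show "N \<subseteq> topspace (subtopology X (\<Union>i\<in>I. S i))" if "N \<in> (\<Union>i\<in>I. \<N> i)" for N
      using that \<N>(2) unfolding is_network_def by fastforce
    fix y U
    assume y: "y \<in> topspace (subtopology X (\<Union>i\<in>I. S i))"
      and U: "openin (subtopology X (\<Union>i\<in>I. S i)) U \<and> y \<in> U"
    then obtain T where T: "openin X T" "U = T \<inter> (\<Union>i\<in>I. S i)"
      by (auto simp: openin_subtopology)
    obtain i where i: "i \<in> I" "y \<in> S i"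
      using y by auto
    have "openin (subtopology X (S i)) (T \<inter> S i)" "y \<in> T \<inter> S i" "y \<in> topspace (subtopology X (S i))"
      using T U i y by (auto simp: openin_subtopology)
    then obtain N where "N \<in> \<N> i" "y \<in> N" "N \<subseteq> T \<inter> S i"
      using \<N>(2)[OF i(1)] unfolding is_network_def by meson
    then show "\<exists>N\<in>(\<Union>i\<in>I. \<N> i). y \<in> N \<and> N \<subseteq> U"
      using i T by blast
  qed
  moreover have "countable (\<Union>i\<in>I. \<N> i)"
    using \<N>(1) assms(1) by simp
  ultimately show ?thesis
    unfolding has_countable_network_def by blast
qed

lemma has_countable_network_singleton: "has_countable_network (subtopology X {x})"
proof -
  have "is_network (subtopology X {x}) {topspace X \<inter> {x}}"
    unfolding is_network_def by auto
  then show ?thesis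
    unfolding has_countable_network_def by blast
qed

text \<open>Every point lies in a network set that fits inside a member of the cover. Choosing one
  such member for each of the countably many fitting network sets yields the subcover.\<close>

lemma has_countable_network_imp_Lindelof:
  assumes "has_countable_network X"
  shows "Lindelof_space X"
  unfolding Lindelof_space_alt
proof (intro allI impI)
  fix \<U>
  assume \<U>: "(\<forall>U\<in>\<U>. openin X U) \<and> topspace X \<subseteq> \<Union>\<U>"
  obtain \<N> where \<N>: "countable \<N>" "is_network X \<N>"
    using assms unfolding has_countable_network_def by auto
  define \<M> where "\<M> = {N \<in> \<N>. \<exists>U\<in>\<U>. N \<subseteq> U}"
  have "\<forall>N\<in>\<M>. \<exists>U. U \<in> \<U> \<and> N \<subseteq> U"
    unfolding \<M>_def by auto
  then obtain g where g: "\<And>N. N \<in> \<M> \<Longrightarrow> g N \<in> \<U> \<and> N \<subseteq> g N"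
    by metis
  have "countable (g ` \<M>)"
    using \<N>(1) by (simp add: \<M>_def)
  moreover have "topspace X \<subseteq> \<Union>(g ` \<M>)"
  proof
    fix x
    assume x: "x \<in> topspace X"
    then obtain U where U: "U \<in> \<U>" "x \<in> U"
      using \<U> by blast
    then obtain N where "N \<in> \<N>" "x \<in> N" "N \<subseteq> U"
      using \<N>(2) x \<U> unfolding is_network_def by meson
    then have "N \<in> \<M>"
      using U unfolding \<M>_def by blast
    then show "x \<in> \<Union>(g ` \<M>)"
      using g \<open>x \<in> N\<close> by blast
  qed
  ultimately show "\<exists>\<V>. countable \<V> \<and> \<V> \<subseteq> \<U> \<and> topspace X \<subseteq> \<Union>\<V>"
    using g by blast
qed

lemma cosmic_space_iff: "cosmic_space X \<longleftrightarrow> regular_t1_space X \<and> has_countable_network X"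
  by (simp add: cosmic_space_def has_countable_network_def)

lemma cosmic_space_subtopology:
  assumes "regular_t1_space X" "has_countable_network (subtopology X S)" "T \<subseteq> S"
  shows "cosmic_space (subtopology X T)"
proof -
  have "has_countable_network (subtopology X T)"
    using has_countable_network_subtopology[OF assms(2), of T] assms(3)
    by (simp add: subtopology_subtopology inf_absorb2)
  then show ?thesis
    using assms(1) by (auto simp: cosmic_space_iff regular_t1_space_def
        intro: regular_space_subtopology t1_space_subtopology)
qed

lemma cosmic_imp_normal_space:
  assumes "cosmic_space X"
  shows "normal_space X"
  using assms has_countable_network_imp_Lindelof regular_Lindelof_imp_normal_space
  by (auto simp: cosmic_space_iff regular_t1_space_def)

subsection \<open>Open partitions\<close>

text \<open>Each \<open>F i\<close> loses what its predecessors cover; closedness of that initial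
  union keeps the remainder open. A point survives in the set of a minimal index containing it.
  Applied both to the naturals and to a well-order of the space.\<close>

lemma disjoint_open_refinement_wf:
  assumes "wf r" and total: "\<And>i j. i \<in> I \<Longrightarrow> j \<in> I \<Longrightarrow> i \<noteq> j \<Longrightarrow> (i, j) \<in> r \<or> (j, i) \<in> r"
    and op: "\<And>i. i \<in> I \<Longrightarrow> openin X (F i)"
    and cl: "\<And>i. i \<in> I \<Longrightarrow> closedin X (\<Union>(F ` {j \<in> I. (j, i) \<in> r}))"
  obtains D where "\<And>i. i \<in> I \<Longrightarrow> openin X (D i)" "\<And>i. i \<in> I \<Longrightarrow> D i \<subseteq> F i"
    "disjoint_family_on D I" "\<Union>(D ` I) = \<Union>(F ` I)"
proof
  define D where "D i = F i - \<Union>(F ` {j \<in> I. (j, i) \<in> r})" for i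
  show "openin X (D i)" if "i \<in> I" for i
    unfolding D_def using op cl that by blast
  show "D i \<subseteq> F i" if "i \<in> I" for i
    by (auto simp: D_def)
  show "disjoint_family_on D I"
    unfolding disjoint_family_on_def D_def using total by blast
  show "\<Union>(D ` I) = \<Union>(F ` I)"
  proof
    show "\<Union>(F ` I) \<subseteq> \<Union>(D ` I)"
    proof
      fix x
      assume "x \<in> \<Union>(F ` I)"
      then obtain i0 where "i0 \<in> {i \<in> I. x \<in> F i}"
        by blast
      then obtain i where "i \<in> {i \<in> I. x \<in> F i}" "\<And>j. (j, i) \<in> r \<Longrightarrow> j \<notin> {i \<in> I. x \<in> F i}"
        by (rule wfE_min[OF \<open>wf r\<close>]) blast
      then show "x \<in> \<Union>(D ` I)"
        unfolding D_def by blast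
    qed
  qed (auto simp: D_def)
qed

lemma wf_total_rel:
  obtains r :: "'a rel" where "wf r" "\<And>i j. i \<noteq> j \<Longrightarrow> (i, j) \<in> r \<or> (j, i) \<in> r"
proof -
  obtain r :: "'a rel" where "well_order_on UNIV r"
    using well_order_on by blast
  then show thesis
    by (intro that[of "r - Id"]) (auto simp: well_order_on_def linear_order_on_def total_on_def)
qed

text \<open>Disjointness makes \<open>snd\<close> injective and covering makes it surjective. It is
  an open map because a set open in an open piece is open in \<open>X\<close>.\<close>

lemma topological_sum_open_partition:
  assumes "open_cover_of X \<U>" "pairwise disjnt \<U>"
  shows "topological_sum_of_subspaces X \<U>"
proof -
  have op: "\<And>U. U \<in> \<U> \<Longrightarrow> openin X U" and cov: "\<Union>\<U> = topspace X"
    using assms(1) by (auto simp: open_cover_of_def)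
  then have sub: "\<And>U. U \<in> \<U> \<Longrightarrow> U \<subseteq> topspace X"
    by blast
  let ?S = "sum_topology (\<lambda>U. subtopology X U) \<U>"
  have top: "topspace ?S = Sigma \<U> id"
    using subsetD[OF sub] by (auto simp: id_def)
  have "homeomorphic_map ?S X snd"
  proof (rule bijective_open_imp_homeomorphic_map)
    show "snd ` topspace ?S = topspace X"
      unfolding top using cov by force
    show "inj_on snd (topspace ?S)"
      unfolding top using assms(2) by (fastforce simp: inj_on_def pairwise_def disjnt_iff)
    show "continuous_map ?S X snd"
      unfolding continuous_map
    proof (intro conjI allI impI)
      show "snd ` topspace ?S \<subseteq> topspace X"
        unfolding top using subsetD[OF sub] by auto
      fix W
      assume W: "openin X W"
      have "{p \<in> topspace ?S. snd p \<in> W} = Sigma \<U> (\<lambda>U. W \<inter> U)"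
        unfolding top by auto
      then show "openin ?S {p \<in> topspace ?S. snd p \<in> W}"
        using W by (auto simp: openin_disjoint_union openin_subtopology)
    qed
    show "open_map ?S X snd"
      unfolding open_map_def
    proof (intro allI impI)
      fix W
      assume "openin ?S W"
      then obtain T where T: "W = Sigma \<U> T" "\<forall>U\<in>\<U>. openin (subtopology X U) (T U)"
        by (auto simp: openin_sum_topology_alt)
      then have "snd ` W = (\<Union>U\<in>\<U>. T U)"
        by force
      moreover have "openin X (T U)" if "U \<in> \<U>" for U
        using T(2) op that by (meson openin_trans_full)
      ultimately show "openin X (snd ` W)"
        by auto
    qed
  qed
  then show ?thesis
    using sub by (simp add: topological_sum_of_subspaces_def)
qed

section \<open>Submetrizability through continuous injections\<close>

lemma submetrizable_space_injection:
  assumes "metrizable_space Y" "continuous_map X Y f" "inj_on f (topspace X)"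
  shows "submetrizable_space X"
proof -
  obtain M d where "Metric_space M d" and Y: "Y = Metric_space.mtopology M d"
    using assms(1) by (auto simp: metrizable_space_def)
  then interpret Metric_space M d
    by simp
  have fM: "f x \<in> M" if "x \<in> topspace X" for x
    using assms(2) that Y by (metis continuous_map_image_subset_topspace image_subset_iff topspace_mtopology)
  \<comment> \<open>The metric of \<open>Y\<close> is pulled back along \<open>f\<close>;
    injectivity turns distance zero into equality.\<close>
  have "Metric_space (topspace X) (\<lambda>x y. d (f x) (f y))"
  proof
    show "d (f x) (f y) = d (f y) (f x)" for x y
      by (rule commute)
    show "d (f x) (f y) = 0 \<longleftrightarrow> x = y" if "x \<in> topspace X" "y \<in> topspace X" for x y
      using that assms(3) fM by (auto simp: inj_on_def)
    show "d (f x) (f z) \<le> d (f x) (f y) + d (f y) (f z)"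
      if "x \<in> topspace X" "y \<in> topspace X" "z \<in> topspace X" for x y z
      using that fM triangle by blast
  qed simp
  moreover have "continuous_map (prod_topology X X) euclideanreal (\<lambda>(x, y). d (f x) (f y))"
  proof -
    have f: "continuous_map X (mtopology_of (metric (M, d))) f"
      using assms(2) by (simp add: Y mtopology_of_def Metric_space_axioms mspace_metric mdist_metric)
    have "continuous_map (prod_topology X X) euclideanreal
        (\<lambda>p. mdist (metric (M, d)) ((f \<circ> fst) p) ((f \<circ> snd) p))"
      by (intro continuous_map_mdist continuous_map_compose[OF _ f] continuous_map_fst continuous_map_snd)
    then show ?thesis
      by (simp add: Metric_space_axioms mdist_metric case_prod_unfold)
  qed
  ultimately show ?thesis
    unfolding submetrizable_space_def by blast
qed

text \<open>One Urysohn function is taken for each pair of network sets with disjoint closures.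
  There are only countably many pairs, and regularity finds such a pair around any two distinct
  points.\<close>

lemma cosmic_imp_separating_sequence:
  assumes "cosmic_space X"
  obtains F :: "nat \<Rightarrow> 'a \<Rightarrow> real" where "\<And>n. continuous_map X euclideanreal (F n)"
    "\<And>x y. x \<in> topspace X \<Longrightarrow> y \<in> topspace X \<Longrightarrow> x \<noteq> y \<Longrightarrow> \<exists>n. F n x \<noteq> F n y"
proof -
  have norm: "normal_space X" and reg: "regular_space X" and t1: "t1_space X"
    using assms cosmic_imp_normal_space by (auto simp: cosmic_space_iff regular_t1_space_def)
  obtain \<N> where \<N>: "countable \<N>" "is_network X \<N>"
    using assms by (auto simp: cosmic_space_iff has_countable_network_def)
  have nb: "\<exists>U V. openin X U \<and> closedin X V \<and> x \<in> U \<and> U \<subseteq> V \<and> V \<subseteq> W" if "openin X W" "x \<in> W" for W x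
    using reg that unfolding neighbourhood_base_of_closedin[symmetric] neighbourhood_base_of by blast
  have "\<exists>f. continuous_map X euclideanreal f \<and>
      (disjnt (X closure_of M) (X closure_of N) \<longrightarrow>
        f ` (X closure_of M) \<subseteq> {0} \<and> f ` (X closure_of N) \<subseteq> {1})" for M N
  proof (cases "disjnt (X closure_of M) (X closure_of N)")
    case True
    then show ?thesis
      by (metis Urysohn_lemma_alt[OF norm] closedin_closure_of)
  next
    case False
    \<comment> \<open>The zero function serves pairs whose closures meet, so that \<open>f\<close>
      can be chosen continuous for all pairs.\<close>
    moreover have "continuous_map X euclideanreal (\<lambda>x. 0)"
      by simp
    ultimately show ?thesis
      by blast
  qed
  then obtain f where f: "\<And>M N. continuous_map X euclideanreal (f M N)"
    "\<And>M N. disjnt (X closure_of M) (X closure_of N) \<Longrightarrow>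
        f M N ` (X closure_of M) \<subseteq> {0} \<and> f M N ` (X closure_of N) \<subseteq> {1}"
    by metis
  \<comment> \<open>Every \<open>f M N\<close> is continuous, so \<open>F n\<close> is continuous
    even if \<open>\<N>\<close> is empty and the enumeration takes an arbitrary value.\<close>
  define F where "F n = case_prod f (from_nat_into (\<N> \<times> \<N>) n)" for n
  show thesis
  proof
    show "continuous_map X euclideanreal (F n)" for n
      using f(1) by (simp add: F_def case_prod_unfold)
    fix x y
    assume xy: "x \<in> topspace X" "y \<in> topspace X" "x \<noteq> y"
    \<comment> \<open>Regularity is used twice: first for a closed neighbourhood \<open>V\<close> of
      \<open>x\<close> missing \<open>y\<close>, then for a closed neighbourhood \<open>V'\<close>
      of \<open>y\<close> missing \<open>V\<close>. Network sets inside \<open>U\<close> and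
      \<open>U'\<close> then have disjoint closures.\<close>
    then have "openin X (topspace X - {y})"
      using t1 by (metis closedin_t1_singleton openin_closedin_eq closedin_def)
    then obtain U V where UV: "openin X U" "closedin X V" "x \<in> U" "U \<subseteq> V" "V \<subseteq> topspace X - {y}"
      using nb xy by (metis DiffI singletonD)
    then have "openin X (topspace X - V)" "y \<in> topspace X - V"
      using xy by auto
    then obtain U' V' where UV': "openin X U'" "closedin X V'" "y \<in> U'" "U' \<subseteq> V'" "V' \<subseteq> topspace X - V"
      using nb by meson
    obtain M N where MN: "M \<in> \<N>" "x \<in> M" "M \<subseteq> U" "N \<in> \<N>" "y \<in> N" "N \<subseteq> U'"
      using \<N>(2) xy UV UV' unfolding is_network_def by meson
    then have cl: "X closure_of M \<subseteq> V" "X closure_of N \<subseteq> V'"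
      using UV UV' by (meson closure_of_minimal order_trans)+
    have "x \<in> X closure_of M" "y \<in> X closure_of N"
      using MN xy by (auto simp: in_closure_of)
    moreover have "disjnt (X closure_of M) (X closure_of N)"
      using cl UV' unfolding disjnt_def by blast
    ultimately have "f M N x = 0" "f M N y = 1"
      using f(2) by blast+
    moreover obtain n where "from_nat_into (\<N> \<times> \<N>) n = (M, N)"
      using from_nat_into_surj[of "\<N> \<times> \<N>" "(M, N)"] \<N>(1) MN by auto
    ultimately show "\<exists>n. F n x \<noteq> F n y"
      by (auto simp: F_def intro!: exI[of _ n])
  qed
qed

lemma submetrizable_cosmic_partition:
  assumes cov: "open_cover_of X \<U>" and dis: "pairwise disjnt \<U>"
    and cos: "\<And>U. U \<in> \<U> \<Longrightarrow> cosmic_space (subtopology X U)"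
  shows "submetrizable_space X"
proof -
  have op: "\<And>U. U \<in> \<U> \<Longrightarrow> openin X U" and cov: "\<Union>\<U> = topspace X"
    using cov by (auto simp: open_cover_of_def)
  then have top: "\<And>U. U \<in> \<U> \<Longrightarrow> topspace (subtopology X U) = U"
    by (simp add: openin_subset inf_absorb2)
  have "\<forall>U\<in>\<U>. \<exists>F :: nat \<Rightarrow> 'a \<Rightarrow> real. (\<forall>n. continuous_map (subtopology X U) euclideanreal (F n)) \<and>
      (\<forall>x\<in>U. \<forall>y\<in>U. x \<noteq> y \<longrightarrow> (\<exists>n. F n x \<noteq> F n y))"
    using cosmic_imp_separating_sequence[OF cos] top by metis
  then obtain F :: "'a set \<Rightarrow> nat \<Rightarrow> 'a \<Rightarrow> real" where
    F: "\<And>U n. U \<in> \<U> \<Longrightarrow> continuous_map (subtopology X U) euclideanreal (F U n)"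
      "\<And>U x y. U \<in> \<U> \<Longrightarrow> x \<in> U \<Longrightarrow> y \<in> U \<Longrightarrow> x \<noteq> y \<Longrightarrow> \<exists>n. F U n x \<noteq> F U n y"
    by metis
  have "\<forall>x\<in>topspace X. \<exists>U. U \<in> \<U> \<and> x \<in> U"
    using cov by blast
  then obtain p where p: "\<And>x. x \<in> topspace X \<Longrightarrow> p x \<in> \<U> \<and> x \<in> p x"
    by metis
  have p_eq: "p x = U" if "U \<in> \<U>" "x \<in> U" for x U
  proof -
    have "x \<in> topspace X"
      using cov that by blast
    then have "p x \<in> \<U>" "x \<in> p x"
      using p by auto
    then show ?thesis
      using pairwiseD[OF dis, of "p x" U] that by (auto simp: disjnt_iff)
  qed
  \<comment> \<open>The discrete factor records the piece, and the countable power of the line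
    records the separating sequence of that piece.\<close>
  let ?Y = "prod_topology (discrete_topology \<U>) (product_topology (\<lambda>n::nat. euclideanreal) UNIV)"
  have "metrizable_space (product_topology (\<lambda>n::nat. euclideanreal) UNIV)"
    by (simp add: metrizable_space_product_topology metrizable_space_euclidean)
  then have "metrizable_space ?Y"
    by (simp add: metrizable_space_prod_topology)
  moreover have "continuous_map X ?Y (\<lambda>x. (p x, \<lambda>n. F (p x) n x))"
    unfolding continuous_map_paired continuous_map_componentwise_UNIV
  proof (intro conjI allI)
    have uniq: "U = U'" if "U \<in> \<U>" "U' \<in> \<U>" "x \<in> topspace X \<inter> U \<inter> U'" for U U' x
      using p_eq[of U x] p_eq[of U' x] that by simp
    \<comment> \<open>Continuity is local: on an open piece \<open>U\<close> the index
      \<open>p\<close> is constant, and the other coordinates agree with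
      \<open>F U n\<close>.\<close>
    show "continuous_map X (discrete_topology \<U>) p"
    proof (rule pasting_lemma[where I=\<U> and T="\<lambda>U. U" and f="\<lambda>U x. U"])
      show "\<exists>U. U \<in> \<U> \<and> x \<in> U \<and> p x = U" if "x \<in> topspace X" for x
        using p that by blast
    qed (use op uniq in auto)
    show "continuous_map X euclideanreal (\<lambda>x. F (p x) n x)" for n
    proof (rule pasting_lemma[where I=\<U> and T="\<lambda>U. U" and f="\<lambda>U. F U n"])
      show "\<exists>U. U \<in> \<U> \<and> x \<in> U \<and> F (p x) n x = F U n x" if "x \<in> topspace X" for x
        using p that by blast
      show "F U n x = F U' n x" if "U \<in> \<U>" "U' \<in> \<U>" "x \<in> topspace X \<inter> U \<inter> U'" for U U' x
        using uniq[OF that] by simp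
    qed (use op F(1) in auto)
  qed
  \<comment> \<open>Equal indices put both points into one piece, where \<open>F\<close> separates
    distinct points.\<close>
  moreover have "inj_on (\<lambda>x. (p x, \<lambda>n. F (p x) n x)) (topspace X)"
  proof (rule inj_onI)
    fix x y
    assume xy: "x \<in> topspace X" "y \<in> topspace X"
      and "(p x, \<lambda>n. F (p x) n x) = (p y, \<lambda>n. F (p y) n y)"
    then have "p x = p y" "\<And>n. F (p x) n x = F (p x) n y"
      by (auto dest: fun_cong)
    then show "x = y"
      using F(2)[of "p x" x y] p xy by metis
  qed
  ultimately show ?thesis
    by (rule submetrizable_space_injection)
qed

subsection \<open>Strong paracompactness\<close>

text \<open>Countably many cozero sets \<open>V i = {f i < 1}\<close> cover the space. The open sets
  \<open>W n = \<Union>i\<le>n. {f i < 1 - 1/(n+1)}\<close> exhaust it, with closed \<open>K n\<close> between \<open>W n\<close> and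
  \<open>W (n+1)\<close>. The shells \<open>W n - \<Union>m\<le>n-2. K m\<close> meet only their neighbours, and the \<open>n\<close>-th one is
  covered by \<open>V 0, \<dots>, V n\<close>.\<close>

lemma strongly_paracompact_regular_Lindelof:
  assumes "regular_t1_space X" "Lindelof_space X"
  shows "strongly_paracompact_space X"
  unfolding strongly_paracompact_space_def
proof (intro allI impI)
  fix \<U>
  assume \<U>: "open_cover_of X \<U>"
  have "completely_regular_space X"
    using assms regular_Lindelof_imp_normal_space normal_imp_completely_regular_space_A
    by (auto simp: regular_t1_space_def)
  \<comment> \<open>The function is 0 at \<open>x\<close> and 1 outside a member \<open>U\<close> of
    the cover, so its sublevel set below 1 is an open neighbourhood of \<open>x\<close> inside
    \<open>U\<close>.\<close>
  then have "\<exists>f U. continuous_map X euclideanreal f \<and> f x < 1 \<and> U \<in> \<U> \<and>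
      {z \<in> topspace X. f z < 1} \<subseteq> U" if x: "x \<in> topspace X" for x
  proof -
    obtain U where U: "U \<in> \<U>" "x \<in> U" "openin X U"
      using \<U> x by (auto simp: open_cover_of_def)
    then have "closedin X (topspace X - U)" "x \<in> topspace X - (topspace X - U)"
      using x by auto
    then obtain f :: "'a \<Rightarrow> real" where "continuous_map X euclideanreal f" "f x = 0"
        "f ` (topspace X - U) \<subseteq> {1}"
      using \<open>completely_regular_space X\<close> unfolding completely_regular_space_alt by blast
    then show ?thesis
      using U(1) by (intro exI[of _ f] exI[of _ U]) fastforce
  qed
  then obtain f :: "'a \<Rightarrow> 'a \<Rightarrow> real" and u where
    "\<And>x. x \<in> topspace X \<Longrightarrow> continuous_map X euclideanreal (f x) \<and> f x x < 1 \<and> u x \<in> \<U> \<and>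
      {z \<in> topspace X. f x z < 1} \<subseteq> u x"
    by metis
  then have f: "\<And>x. x \<in> topspace X \<Longrightarrow> continuous_map X euclideanreal (f x)"
      "\<And>x. x \<in> topspace X \<Longrightarrow> f x x < 1"
      "\<And>x. x \<in> topspace X \<Longrightarrow> u x \<in> \<U>"
      "\<And>x. x \<in> topspace X \<Longrightarrow> {z \<in> topspace X. f x z < 1} \<subseteq> u x"
    by blast+
  have lt: "openin X {z \<in> topspace X. f x z < a}" and le: "closedin X {z \<in> topspace X. f x z \<le> a}"
    if "x \<in> topspace X" for x a
    using f(1)[OF that] unfolding continuous_map_upper_lower_semicontinuous_lte by blast+
  have "\<exists>\<V>. countable \<V> \<and> \<V> \<subseteq> (\<lambda>x. {z \<in> topspace X. f x z < 1}) ` topspace X \<and> \<Union>\<V> = topspace X"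
    using lt f(2) by (intro Lindelof_spaceD[OF assms(2)]) auto
  then obtain A where A: "countable A" "A \<subseteq> topspace X"
    "(\<Union>x\<in>A. {z \<in> topspace X. f x z < 1}) = topspace X"
    by (metis (no_types, lifting) countable_subset_image)
  show "\<exists>\<V>. open_cover_of X \<V> \<and> cover_refines \<V> \<U> \<and> star_finite \<V>"
  \<comment> \<open>Enumerating \<open>A\<close> by the naturals requires a nonempty set.\<close>
  proof (cases "A = {}")
    case True
    then have "topspace X = {}"
      using A(3) by auto
    then show ?thesis
      by (intro exI[of _ "{}"]) (simp add: open_cover_of_def cover_refines_def star_finite_def)
  next
    case False
    define a where "a = from_nat_into A"
    have a: "a n \<in> topspace X" for n
      using A(2) False from_nat_into[of A n] by (auto simp: a_def)
    have a_cov: "\<exists>n. f (a n) z < 1" if "z \<in> topspace X" for z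
      using A that from_nat_into_surj[OF A(1)] unfolding a_def by blast
    define V where "V i = {z \<in> topspace X. f (a i) z < 1}" for i
    define W where "W n = (\<Union>i\<in>{..n}. {z \<in> topspace X. f (a i) z < 1 - 1 / real (Suc n)})" for n
    define K where "K n = (\<Union>i\<in>{..n}. {z \<in> topspace X. f (a i) z \<le> 1 - 1 / real (Suc n)})" for n
    \<comment> \<open>Writing \<open>m + 2 \<le> n\<close> avoids truncated subtraction: nothing is
      removed when \<open>n\<close> is 0 or 1.\<close>
    define S where "S n = W n - (\<Union>m\<in>{m. m + 2 \<le> n}. K m)" for n
    have V_open: "openin X (V i)" for i
      unfolding V_def using lt a by blast
    have W_open: "openin X (W n)" for n
      unfolding W_def using lt a by blast
    have K_closed: "closedin X (K n)" for n
      unfolding K_def using le a by (intro closedin_Union) auto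
    have "finite {m. m + 2 \<le> n}" for n :: nat
      by (rule finite_subset[of _ "{..n}"]) auto
    then have S_open: "openin X (S n)" for n
      unfolding S_def using W_open K_closed by (intro openin_diff closedin_Union) auto
    have WK: "W n \<subseteq> K n" for n
      unfolding W_def K_def by fastforce
    have KW: "K n \<subseteq> W (Suc n)" for n
    proof -
      have "1 / real (Suc (Suc n)) < 1 / real (Suc n)"
        by (simp add: divide_simps)
      then have "f (a i) z < 1 - 1 / real (Suc (Suc n))" if "f (a i) z \<le> 1 - 1 / real (Suc n)" for i z
        using that by linarith
      then have "{z \<in> topspace X. f (a i) z \<le> 1 - 1 / real (Suc n)}
          \<subseteq> {z \<in> topspace X. f (a i) z < 1 - 1 / real (Suc (Suc n))}" for i
        by blast
      then show ?thesis
        unfolding W_def K_def by (intro UN_mono) auto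
    qed
    have W_cov: "\<exists>n. z \<in> W n" if z: "z \<in> topspace X" for z
    proof -
      obtain i where i: "f (a i) z < 1"
        using a_cov z by blast
      then obtain m where m: "1 / real (Suc m) < 1 - f (a i) z"
        using nat_approx_posE[of "1 - f (a i) z"] by auto
      \<comment> \<open>The stage must reach \<open>i\<close>, for the \<open>i\<close>-th set to
        take part in the union, and \<open>m\<close>, for the threshold to exceed the value at
        \<open>z\<close>.\<close>
      have "1 / real (Suc (max i m)) \<le> 1 / real (Suc m)"
        by (simp add: divide_simps)
      then have "z \<in> W (max i m)"
        unfolding W_def using z m by (intro UN_I[of i]) auto
      then show ?thesis
        by blast
    qed
    have S_cov: "\<exists>n. z \<in> S n" if z: "z \<in> topspace X" for z
    proof -
      \<comment> \<open>At the first stage containing \<open>z\<close> no removed set contains it: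
        \<open>K m\<close> lies in \<open>W (Suc m)\<close>, and \<open>m + 2 \<le> n\<close> makes
        \<open>Suc m\<close> an earlier stage.\<close>
      define n where "n = (LEAST n. z \<in> W n)"
      have n: "z \<in> W n" "\<And>m. m < n \<Longrightarrow> z \<notin> W m"
        unfolding n_def using W_cov[OF z] by (auto intro: LeastI dest: not_less_Least)
      have "z \<notin> K m" if "m + 2 \<le> n" for m
        using n(2)[of "Suc m"] that KW by auto
      then show ?thesis
        using n(1) unfolding S_def by blast
    qed
    \<comment> \<open>\<open>S n\<close> lies in \<open>W n\<close>, hence in \<open>K n\<close>,
      which is removed from \<open>S m\<close>.\<close>
    have S_far: "S n \<inter> S m = {}" if "n + 2 \<le> m" for n m
      using that WK unfolding S_def by blast
    define \<V> where "\<V> = (\<lambda>(i, n). V i \<inter> S n) ` {(i, n). i \<le> n}"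
    show ?thesis
    proof (intro exI conjI)
      have "\<exists>i\<le>n. z \<in> V i \<inter> S n" if zS: "z \<in> S n" for z n
      proof -
        obtain i where i: "i \<le> n" "z \<in> topspace X" "f (a i) z < 1 - 1 / real (Suc n)"
          using zS unfolding S_def W_def by blast
        moreover have "1 - 1 / real (Suc n) < 1"
          by simp
        ultimately have "f (a i) z < 1"
          by linarith
        then show ?thesis
          using zS i unfolding V_def by blast
      qed
      then have "topspace X \<subseteq> \<Union>\<V>"
        unfolding \<V>_def using S_cov by fastforce
      moreover have "\<forall>U\<in>\<V>. openin X U"
        unfolding \<V>_def using V_open S_open by auto
      ultimately show "open_cover_of X \<V>"
        unfolding open_cover_of_def using openin_subset by blast
      show "cover_refines \<V> \<U>"
        unfolding cover_refines_def
      proof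
        fix Z
        assume "Z \<in> \<V>"
        then obtain i where "Z \<subseteq> V i"
          unfolding \<V>_def by auto
        then have "Z \<subseteq> u (a i)"
          using f(4)[OF a[of i]] unfolding V_def by (rule order_trans)
        then show "\<exists>U\<in>\<U>. Z \<subseteq> U"
          using f(3)[OF a[of i]] by blast
      qed
      show "star_finite \<V>"
        unfolding star_finite_def
      proof
        fix Z
        assume "Z \<in> \<V>"
        then obtain i n where Z: "Z = V i \<inter> S n"
          unfolding \<V>_def by auto
        \<comment> \<open>A member meeting \<open>Z\<close> has shell index
          \<open>m \<le> Suc n\<close>, and \<open>j \<le> m\<close> bounds its other index, leaving
          finitely many pairs.\<close>
        have "{Y \<in> \<V>. Y \<inter> Z \<noteq> {}} \<subseteq> (\<lambda>(i, n). V i \<inter> S n) ` ({..Suc n} \<times> {..Suc n})"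
        proof
          fix Y
          assume "Y \<in> {Y \<in> \<V>. Y \<inter> Z \<noteq> {}}"
          then obtain j m where Y: "Y = V j \<inter> S m" "j \<le> m" "Y \<inter> Z \<noteq> {}"
            unfolding \<V>_def by auto
          then have "S n \<inter> S m \<noteq> {}"
            using Z by blast
          then have "m \<le> Suc n"
            using S_far[of n m] by fastforce
          then show "Y \<in> (\<lambda>(i, n). V i \<inter> S n) ` ({..Suc n} \<times> {..Suc n})"
            using Y by auto
        qed
        then show "finite {Y \<in> \<V>. Y \<inter> Z \<noteq> {}}"
          by (rule finite_subset) auto
      qed
    qed
  qed
qed

text \<open>Star-finite refinements are chosen separately on the pieces. Members from different
  pieces are disjoint, so their union stays star-finite.\<close>

lemma strongly_paracompact_open_partition:
  assumes cov: "open_cover_of X \<U>" and dis: "pairwise disjnt \<U>"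
    and sp: "\<And>U. U \<in> \<U> \<Longrightarrow> strongly_paracompact_space (subtopology X U)"
  shows "strongly_paracompact_space X"
  unfolding strongly_paracompact_space_def
proof (intro allI impI)
  fix \<W>
  assume \<W>: "open_cover_of X \<W>"
  have op: "\<And>U. U \<in> \<U> \<Longrightarrow> openin X U" and cov: "\<Union>\<U> = topspace X"
    using cov by (auto simp: open_cover_of_def)
  then have top: "\<And>U. U \<in> \<U> \<Longrightarrow> topspace (subtopology X U) = U"
    by (simp add: openin_subset inf_absorb2)
  have "\<forall>U\<in>\<U>. \<exists>\<V>. open_cover_of (subtopology X U) \<V> \<and> cover_refines \<V> ((\<inter>) U ` \<W>) \<and> star_finite \<V>"
  proof
    fix U
    assume U: "U \<in> \<U>"
    have "open_cover_of (subtopology X U) ((\<inter>) U ` \<W>)"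
      using \<W> openin_subset[OF op[OF U]] by (auto simp: open_cover_of_def openin_subtopology_Int2)
    then show "\<exists>\<V>. open_cover_of (subtopology X U) \<V> \<and> cover_refines \<V> ((\<inter>) U ` \<W>) \<and> star_finite \<V>"
      using sp[OF U] unfolding strongly_paracompact_space_def by blast
  qed
  then obtain \<V> where \<V>: "\<And>U. U \<in> \<U> \<Longrightarrow> open_cover_of (subtopology X U) (\<V> U)"
    "\<And>U. U \<in> \<U> \<Longrightarrow> cover_refines (\<V> U) ((\<inter>) U ` \<W>)" "\<And>U. U \<in> \<U> \<Longrightarrow> star_finite (\<V> U)"
    by metis
  have un: "\<Union>(\<V> U) = U" if "U \<in> \<U>" for U
    using \<V>(1) top that by (simp add: open_cover_of_def)
  show "\<exists>\<V>. open_cover_of X \<V> \<and> cover_refines \<V> \<W> \<and> star_finite \<V>"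
  proof (intro exI conjI)
    have "openin X V" if "U \<in> \<U>" "V \<in> \<V> U" for U V
      using \<V>(1) op that unfolding open_cover_of_def by (meson openin_trans_full)
    moreover have "\<Union>(\<Union>(\<V> ` \<U>)) = (\<Union>U\<in>\<U>. \<Union>(\<V> U))"
      by blast
    then have "\<Union>(\<Union>(\<V> ` \<U>)) = topspace X"
      using un cov by simp
    ultimately show "open_cover_of X (\<Union>(\<V> ` \<U>))"
      unfolding open_cover_of_def by blast
    show "cover_refines (\<Union>(\<V> ` \<U>)) \<W>"
      using \<V>(2) unfolding cover_refines_def by fastforce
    show "star_finite (\<Union>(\<V> ` \<U>))"
      unfolding star_finite_def
    proof
      fix V
      assume "V \<in> \<Union>(\<V> ` \<U>)"
      then obtain U where U: "U \<in> \<U>" "V \<in> \<V> U"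
        by blast
      have "W \<in> \<V> U" if W: "U' \<in> \<U>" "W \<in> \<V> U'" "W \<inter> V \<noteq> {}" for W U'
      proof -
        have "U' \<inter> U \<noteq> {}"
          using W U un by blast
        then have "U' = U"
          using dis W(1) U(1) by (auto simp: pairwise_def disjnt_def)
        then show ?thesis
          using W by simp
      qed
      then have "{W \<in> \<Union>(\<V> ` \<U>). W \<inter> V \<noteq> {}} \<subseteq> {W \<in> \<V> U. W \<inter> V \<noteq> {}}"
        by blast
      moreover have "finite {W \<in> \<V> U. W \<inter> V \<noteq> {}}"
        using \<V>(3)[OF U(1)] U(2) by (simp add: star_finite_def)
      ultimately show "finite {W \<in> \<Union>(\<V> ` \<U>). W \<inter> V \<noteq> {}}"
        by (rule finite_subset)
    qed
  qed
qed

subsection \<open>Translates in topological lops\<close>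

context topological_lop
begin

lemma mul_in: "x \<in> topspace X \<Longrightarrow> y \<in> topspace X \<Longrightarrow> mul x y \<in> topspace X"
  using continuous_map_image_subset_topspace[OF continuous_mul] by force

text \<open>Surjectivity of the shear gives a solution and injectivity its uniqueness, as the
  definite description in \<open>left_div\<close> requires.\<close>

lemma left_div:
  assumes "a \<in> topspace X" "b \<in> topspace X"
  shows "left_div X mul a b \<in> topspace X" "mul a (left_div X mul a b) = b"
proof -
  let ?f = "\<lambda>(x, y). (x, mul x y)"
  have "(a, b) \<in> ?f ` topspace (prod_topology X X)"
    using assms homeomorphic_imp_surjective_map[OF homeomorphic_shear] by simp
  then obtain x where x: "x \<in> topspace X" "mul a x = b"
    by auto
  have "y = x" if "y \<in> topspace X" "mul a y = b" for y
    using inj_onD[OF homeomorphic_imp_injective_map[OF homeomorphic_shear], of "(a, y)" "(a, x)"] that x assms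
    by simp
  then have "\<exists>!x. x \<in> topspace X \<and> mul a x = b"
    using x by blast
  then have "left_div X mul a b \<in> topspace X \<and> mul a (left_div X mul a b) = b"
    unfolding left_div_def by (rule theI')
  then show "left_div X mul a b \<in> topspace X" "mul a (left_div X mul a b) = b"
    by auto
qed

lemma left_div_eq:
  assumes "a \<in> topspace X" "x \<in> topspace X"
  shows "left_div X mul a (mul a x) = x"
  using inj_onD[OF homeomorphic_imp_injective_map[OF homeomorphic_shear],
      of "(a, left_div X mul a (mul a x))" "(a, x)"] assms left_div[OF assms(1) mul_in[OF assms]]
  by simp

text \<open>Left division is the second coordinate of the inverse shear.\<close>

lemma continuous_left_div:
  "continuous_map (prod_topology X X) X (\<lambda>(x, y). left_div X mul x y)"
proof -
  obtain g where g: "homeomorphic_maps (prod_topology X X) (prod_topology X X) (\<lambda>(x, y). (x, mul x y)) g"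
    using homeomorphic_shear unfolding homeomorphic_map_maps by blast
  have "continuous_map (prod_topology X X) X (snd \<circ> g)"
    using g by (simp add: homeomorphic_maps_def continuous_map_pairwise)
  then show ?thesis
  proof (rule continuous_map_eq)
    fix p
    assume "p \<in> topspace (prod_topology X X)"
    then obtain x y where p: "p = (x, y)" "x \<in> topspace X" "y \<in> topspace X"
      by auto
    then have "g (x, mul x (left_div X mul x y)) = (x, left_div X mul x y)"
      using g left_div(1)[OF p(2,3)] by (simp add: homeomorphic_maps_def)
    then show "(snd \<circ> g) p = (case p of (x, y) \<Rightarrow> left_div X mul x y)"
      using p left_div(2)[OF p(2,3)] by simp
  qed
qed

text \<open>Viewing a translate as a preimage under the continuous left division transfers openness
  and closedness from \<open>S\<close> to it.\<close>

lemma left_translate_eq: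
  assumes "x \<in> topspace X" "S \<subseteq> topspace X"
  shows "mul x ` S = {y \<in> topspace X. left_div X mul x y \<in> S}"
proof
  show "mul x ` S \<subseteq> {y \<in> topspace X. left_div X mul x y \<in> S}"
    using assms mul_in left_div_eq by auto
  show "{y \<in> topspace X. left_div X mul x y \<in> S} \<subseteq> mul x ` S"
  proof
    fix y
    assume y: "y \<in> {y \<in> topspace X. left_div X mul x y \<in> S}"
    then have "y = mul x (left_div X mul x y)"
      using left_div(2)[OF assms(1)] by simp
    then show "y \<in> mul x ` S"
      using y by blast
  qed
qed

lemma continuous_left_div_right:
  assumes "x \<in> topspace X"
  shows "continuous_map X X (left_div X mul x)"
proof -
  have "continuous_map X (prod_topology X X) (\<lambda>y. (x, y))"
    using assms by (simp add: continuous_map_pairedI)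
  from continuous_map_compose[OF this continuous_left_div] show ?thesis
    by (simp add: o_def)
qed

lemma continuous_left_div_left:
  assumes "y \<in> topspace X"
  shows "continuous_map X X (\<lambda>x. left_div X mul x y)"
proof -
  have "continuous_map X (prod_topology X X) (\<lambda>x. (x, y))"
    using assms by (simp add: continuous_map_pairedI)
  from continuous_map_compose[OF this continuous_left_div] show ?thesis
    by (simp add: o_def)
qed

lemma openin_left_translate:
  assumes "x \<in> topspace X" "openin X S"
  shows "openin X (mul x ` S)"
  using openin_continuous_map_preimage[OF continuous_left_div_right[OF assms(1)] assms(2)]
  by (simp add: left_translate_eq assms openin_subset)

lemma closedin_left_translate:
  assumes "x \<in> topspace X" "closedin X S"
  shows "closedin X (mul x ` S)"
  using closedin_continuous_map_preimage[OF continuous_left_div_right[OF assms(1)] assms(2)]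
  by (simp add: left_translate_eq assms closedin_subset)

text \<open>If \<open>y\<close> is adherent to \<open>S\<close>, then \<open>s\<^sup>-\<^sup>1y \<in> V\<close> for some \<open>s \<in> S\<close> close to \<open>y\<close>, because
  \<open>y\<^sup>-\<^sup>1y = e\<close>; hence \<open>y = s(s\<^sup>-\<^sup>1y) \<in> S\<close>.\<close>

lemma closedin_right_invariant:
  assumes "openin X V" "e \<in> V" "S \<subseteq> topspace X"
    and inv: "\<And>s v. s \<in> S \<Longrightarrow> v \<in> V \<Longrightarrow> mul s v \<in> S"
  shows "closedin X S"
proof -
  have "X closure_of S \<subseteq> S"
  proof
    fix y
    assume y: "y \<in> X closure_of S"
    then have yX: "y \<in> topspace X"
      by (simp add: in_closure_of)
    have "left_div X mul y y = e"
      using left_div_eq[OF yX unit_in] right_unit[OF yX] by simp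
    moreover have "openin X {x \<in> topspace X. left_div X mul x y \<in> V}"
      using openin_continuous_map_preimage[OF continuous_left_div_left[OF yX] assms(1)] .
    moreover have "y \<in> {x \<in> topspace X. left_div X mul x y \<in> V}"
      using calculation(1) yX assms(2) by simp
    ultimately obtain s where "s \<in> S" "s \<in> {x \<in> topspace X. left_div X mul x y \<in> V}"
      using y in_closure_of[of y X S] by meson
    then have s: "s \<in> S" "s \<in> topspace X" "left_div X mul s y \<in> V"
      by auto
    then show "y \<in> S"
      using inv[OF s(1,3)] left_div(2)[OF s(2) yX] by simp
  qed
  then show ?thesis
    using assms(3) closure_of_subset_eq by blast
qed

text \<open>Around each \<open>s\<close> in \<open>S\<close> the translate of \<open>V\<close> by
  \<open>s\<close> is an open neighbourhood contained in \<open>S\<close>.\<close>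

lemma openin_right_invariant:
  assumes "openin X V" "e \<in> V" "S \<subseteq> topspace X"
    and inv: "\<And>s v. s \<in> S \<Longrightarrow> v \<in> V \<Longrightarrow> mul s v \<in> S"
  shows "openin X S"
proof (subst openin_subopen, intro ballI exI conjI)
  fix s
  assume s: "s \<in> S"
  show "openin X (mul s ` V)"
    using openin_left_translate s assms(1,3) by blast
  show "s \<in> mul s ` V"
    using s right_unit assms(2,3) by (metis image_eqI subsetD)
  show "mul s ` V \<subseteq> S"
    using inv s by blast
qed

text \<open>The products are bracketed to the left, \<open>((x v1) v2) v3\<close> and so on. Without
  associativity they need not be translates of \<open>x\<close> by products of elements of
  \<open>V\<close>.\<close>

fun orbit :: "'a set \<Rightarrow> 'a \<Rightarrow> nat \<Rightarrow> 'a set" where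
  "orbit V x 0 = {x}"
| "orbit V x (Suc n) = (\<lambda>(s, v). mul s v) ` (orbit V x n \<times> V)"

lemma orbit_subset:
  assumes "x \<in> topspace X" "V \<subseteq> topspace X"
  shows "orbit V x n \<subseteq> topspace X"
  by (induction n) (use assms mul_in in auto)

text \<open>Each stage is the continuous image under multiplication of the previous stage times
  \<open>V\<close>, so countable networks propagate by induction.\<close>

lemma has_countable_network_orbit:
  assumes "x \<in> topspace X" "V \<subseteq> topspace X" "has_countable_network (subtopology X V)"
  shows "has_countable_network (subtopology X (orbit V x n))"
proof (induction n)
  case 0
  show ?case
    by (simp add: has_countable_network_singleton)
next
  case (Suc n)
  let ?O = "orbit V x n"
  have prod: "prod_topology (subtopology X ?O) (subtopology X V) =
      subtopology (prod_topology X X) (?O \<times> V)"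
    by (rule subtopology_Times[symmetric])
  show ?case
  proof (rule has_countable_network_image[OF has_countable_network_prod[OF Suc assms(3)]])
    show "continuous_map (prod_topology (subtopology X ?O) (subtopology X V))
        (subtopology X (orbit V x (Suc n))) (\<lambda>(s, v). mul s v)"
      unfolding prod
      by (intro continuous_map_into_subtopology continuous_map_from_subtopology[OF continuous_mul]) auto
    show "(\<lambda>(s, v). mul s v) ` topspace (prod_topology (subtopology X ?O) (subtopology X V)) =
        topspace (subtopology X (orbit V x (Suc n)))"
      using assms orbit_subset[OF assms(1,2)]
      by (simp add: inf_absorb2 del: orbit.simps) simp
  qed
qed

section \<open>Open partition refining the translates\<close>

lemma disjoint_open_refinement_of_translates:
  assumes V: "openin X V" "e \<in> V" "has_countable_network (subtopology X V)"
    and mul_V: "\<And>a b. a \<in> V \<Longrightarrow> b \<in> V \<Longrightarrow> mul a b \<in> V"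
  obtains \<U> where "open_cover_of X \<U>" "pairwise disjnt \<U>"
    "cover_refines \<U> {mul x ` V |x. x \<in> topspace X}"
proof -
  have VX: "V \<subseteq> topspace X"
    using V(1) by (rule openin_subset)
  \<comment> \<open>Being closed under multiplication, \<open>V\<close> is invariant under right
    multiplication by itself; hence its left translates are closed as well.\<close>
  have V_closed: "closedin X V"
    using V(1,2) VX mul_V by (rule closedin_right_invariant)
  define S where "S x = (\<Union>n. orbit V x n)" for x
  have SX: "S x \<subseteq> topspace X" if "x \<in> topspace X" for x
    using orbit_subset[OF that VX] unfolding S_def by blast
  have S_self: "x \<in> S x" for x
    unfolding S_def by (rule UN_I[of 0]) auto
  have S_inv: "mul s v \<in> S x" if s: "s \<in> S x" and v: "v \<in> V" for s v x
  proof -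
    obtain n where "s \<in> orbit V x n"
      using s unfolding S_def by blast
    then have "mul s v \<in> orbit V x (Suc n)"
      using v by force
    then show ?thesis
      unfolding S_def by blast
  qed
  have S_open: "openin X (S x)" if "x \<in> topspace X" for x
    using V(1,2) SX[OF that] S_inv by (rule openin_right_invariant)
  \<comment> \<open>Right invariance survives arbitrary unions, so even infinite unions of hulls are
    closed. This is what permits a transfinite disjointification.\<close>
  have S_closed: "closedin X (\<Union>(S ` A))" if "A \<subseteq> topspace X" for A
  proof (rule closedin_right_invariant[OF V(1,2)])
    show "\<Union>(S ` A) \<subseteq> topspace X"
      using SX that by blast
  qed (use S_inv in blast)
  have "\<exists>D. (\<forall>n :: nat. openin X (D n) \<and> (\<exists>z\<in>topspace X. D n \<subseteq> mul z ` V)) \<and>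
      disjoint_family D \<and> S x \<subseteq> \<Union>(range D)" if x: "x \<in> topspace X" for x
  proof -
    have "Lindelof_space (subtopology X (S x))"
      unfolding S_def using has_countable_network_orbit[OF x VX V(3)]
      by (intro has_countable_network_imp_Lindelof has_countable_network_UN) auto
    moreover have "openin (subtopology X (S x)) (mul z ` V)" if "z \<in> S x" for z
      using openin_left_translate[OF _ V(1)] SX[OF x] S_inv that
      by (subst openin_open_subtopology[OF S_open[OF x]]) blast
    moreover have "topspace (subtopology X (S x)) \<subseteq> (\<Union>z\<in>S x. mul z ` V)"
    proof
      fix z
      assume z: "z \<in> topspace (subtopology X (S x))"
      then have "z = mul z e"
        using right_unit by simp
      then show "z \<in> (\<Union>z\<in>S x. mul z ` V)"
        using z V(2) by auto
    qed
    ultimately obtain \<V> where \<V>: "countable \<V>" "\<V> \<subseteq> (\<lambda>z. mul z ` V) ` S x" "S x \<subseteq> \<Union>\<V>"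
      unfolding Lindelof_space_alt using SX[OF x]
      by (metis (no_types, lifting) imageE inf_absorb2 topspace_subtopology)
    then obtain Z where Z: "countable Z" "Z \<subseteq> S x" "S x \<subseteq> (\<Union>z\<in>Z. mul z ` V)"
      by (metis countable_subset_image)
    define z where "z = from_nat_into Z"
    have "Z \<noteq> {}"
      using Z(3) S_self by auto
    then have zX: "z n \<in> topspace X" for n
      using from_nat_into[of Z n] Z(2) SX[OF x] by (auto simp: z_def)
    \<comment> \<open>Along the naturals only finitely many closed translates precede each one, so
      the initial unions are closed.\<close>
    obtain D where D: "\<And>n. openin X (D n)" "\<And>n. D n \<subseteq> mul (z n) ` V" "disjoint_family D"
      "\<Union>(range D) = (\<Union>n. mul (z n) ` V)"
    proof (rule disjoint_open_refinement_wf[of less_than UNIV X "\<lambda>n. mul (z n) ` V"])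
      show "openin X (mul (z n) ` V)" for n
        using openin_left_translate[OF zX V(1)] .
      show "closedin X (\<Union>((\<lambda>n. mul (z n) ` V) ` {j \<in> UNIV. (j, i) \<in> less_than}))" for i
        using closedin_left_translate[OF zX V_closed] by (intro closedin_Union) auto
    qed auto
    have "range z = Z"
      unfolding z_def using \<open>Z \<noteq> {}\<close> Z(1) by (rule range_from_nat_into)
    then have "S x \<subseteq> (\<Union>w\<in>range z. mul w ` V)"
      using Z(3) by simp
    then have "S x \<subseteq> \<Union>(range D)"
      using D(4) by simp
    moreover have "\<exists>w\<in>topspace X. D n \<subseteq> mul w ` V" for n
      using D(2) zX by blast
    ultimately show ?thesis
      using D(1,3) by blast
  qed
  then obtain D :: "'a \<Rightarrow> nat \<Rightarrow> 'a set" where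
    D: "\<And>x. x \<in> topspace X \<Longrightarrow> (\<forall>n. openin X (D x n) \<and> (\<exists>z\<in>topspace X. D x n \<subseteq> mul z ` V)) \<and>
      disjoint_family (D x) \<and> S x \<subseteq> \<Union>(range (D x))"
    by metis
  obtain r :: "'a rel" where r: "wf r" "\<And>i j. i \<noteq> j \<Longrightarrow> (i, j) \<in> r \<or> (j, i) \<in> r"
    by (rule wf_total_rel) blast
  obtain E where E: "\<And>x. x \<in> topspace X \<Longrightarrow> openin X (E x)" "\<And>x. x \<in> topspace X \<Longrightarrow> E x \<subseteq> S x"
    "disjoint_family_on E (topspace X)" "\<Union>(E ` topspace X) = \<Union>(S ` topspace X)"
  proof (rule disjoint_open_refinement_wf[OF r(1), of "topspace X" X S])
    show "closedin X (\<Union>(S ` {j \<in> topspace X. (j, i) \<in> r}))" for i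
      by (rule S_closed) blast
  qed (use r(2) S_open in auto)
  \<comment> \<open>\<open>E\<close> separates pieces from different hulls, and \<open>D x\<close>
    separates pieces within one hull while placing each in a translate.\<close>
  define \<U> where "\<U> = (\<lambda>(x, n). E x \<inter> D x n) ` (topspace X \<times> UNIV)"
  show thesis
  proof
    have op: "openin X U" if "U \<in> \<U>" for U
      using that E(1) D unfolding \<U>_def by auto
    have "topspace X \<subseteq> \<Union>\<U>"
    proof
      fix y
      assume "y \<in> topspace X"
      then have "y \<in> \<Union>(E ` topspace X)"
        using S_self E(4) by blast
      then obtain x where x: "x \<in> topspace X" "y \<in> E x"
        by blast
      then obtain n where "y \<in> D x n"
        using D[OF x(1)] E(2)[OF x(1)] by blast
      then have "y \<in> E x \<inter> D x n" "E x \<inter> D x n \<in> \<U>"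
        using x unfolding \<U>_def by auto
      then show "y \<in> \<Union>\<U>"
        by blast
    qed
    then show "open_cover_of X \<U>"
      using op openin_subset unfolding open_cover_of_def by blast
    show "pairwise disjnt \<U>"
    proof (rule pairwiseI)
      fix A B
      assume "A \<in> \<U>" "B \<in> \<U>" "A \<noteq> B"
      then obtain x m y n where AB: "A = E x \<inter> D x m" "x \<in> topspace X"
        "B = E y \<inter> D y n" "y \<in> topspace X" "(x, m) \<noteq> (y, n)"
        unfolding \<U>_def by auto
      show "disjnt A B"
      proof (cases "x = y")
        case True
        then have "D x m \<inter> D x n = {}"
          using D[OF AB(2)] AB(5) by (auto simp: disjoint_family_on_def)
        then show ?thesis
          using AB True by (auto simp: disjnt_def)
      next
        case False
        then have "E x \<inter> E y = {}"
          using E(3) AB by (auto simp: disjoint_family_on_def)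
        then show ?thesis
          using AB by (auto simp: disjnt_def)
      qed
    qed
    show "cover_refines \<U> {mul x ` V |x. x \<in> topspace X}"
      unfolding cover_refines_def
    proof
      fix U
      assume "U \<in> \<U>"
      then obtain x n where U: "x \<in> topspace X" "U = E x \<inter> D x n"
        unfolding \<U>_def by auto
      then obtain z where "z \<in> topspace X" "D x n \<subseteq> mul z ` V"
        using D by blast
      then show "\<exists>W\<in>{mul x ` V |x. x \<in> topspace X}. U \<subseteq> W"
        using U(2) by blast
    qed
  qed
qed

end

section \<open>Cosmic pieces and the topological consequences\<close>

theorem theorem3p4:
  fixes X :: "'a topology" and mul :: "'a \<Rightarrow> 'a \<Rightarrow> 'a" and e :: 'a and H :: "'a set"
  assumes "topological_lop X mul e"
    and "regular_t1_space X"
    and "sublop X mul H"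
    and "openin X H"
    and "cosmic_space (subtopology X H)"
  shows "open_cover_of X {mul x ` H |x. x \<in> topspace X} \<and>
         (\<exists>\<U>. open_cover_of X \<U> \<and> pairwise disjnt \<U> \<and>
               cover_refines \<U> {mul x ` H |x. x \<in> topspace X}) \<and>
         (\<exists>\<C>. topological_sum_of_subspaces X \<C> \<and>
               (\<forall>C\<in>\<C>. cosmic_space (subtopology X C))) \<and>
         submetrizable_space X \<and>
         strongly_paracompact_space X"
proof -
  interpret topological_lop X mul e
    by fact
  have HX: "H \<subseteq> topspace X" and mul_H: "\<And>a b. a \<in> H \<Longrightarrow> b \<in> H \<Longrightarrow> mul a b \<in> H"
    using assms(3) by (auto simp: sublop_def)
  obtain h where h: "h \<in> H"
    using assms(3) by (auto simp: sublop_def)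
  \<comment> \<open>Since \<open>mul h e = h\<close>, dividing any element of \<open>H\<close> by
    itself gives the unit, which therefore lies in the sublop.\<close>
  then have "left_div X mul h h = e"
    using left_div_eq[of h e] right_unit[of h] unit_in HX by auto
  then have eH: "e \<in> H"
    using assms(3) h unfolding sublop_def by metis
  have netH: "has_countable_network (subtopology X H)"
    using assms(5) by (simp add: cosmic_space_iff)
  have "x \<in> mul x ` H" if "x \<in> topspace X" for x
    using right_unit[OF that] eH by (metis image_eqI)
  then have "topspace X \<subseteq> \<Union>{mul x ` H |x. x \<in> topspace X}"
    by blast
  moreover have "\<forall>W\<in>{mul x ` H |x. x \<in> topspace X}. openin X W"
    using openin_left_translate[OF _ assms(4)] by auto
  moreover have "\<Union>{mul x ` H |x. x \<in> topspace X} \<subseteq> topspace X"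
    using mul_in HX by auto
  ultimately have "open_cover_of X {mul x ` H |x. x \<in> topspace X}"
    unfolding open_cover_of_def by (intro conjI equalityI)
  moreover obtain \<U> where \<U>: "open_cover_of X \<U>" "pairwise disjnt \<U>"
      "cover_refines \<U> {mul x ` H |x. x \<in> topspace X}"
    using disjoint_open_refinement_of_translates[OF assms(4) eH netH mul_H] .
  moreover have net_translate: "has_countable_network (subtopology X (mul x ` H))"
    if "x \<in> topspace X" for x
  proof -
    \<comment> \<open>A translate is the first orbit stage, so it inherits a countable
      network.\<close>
    have "orbit H x 1 = mul x ` H"
      by force
    then show ?thesis
      using has_countable_network_orbit[OF that HX netH, of 1] by simp
  qed
  \<comment> \<open>A piece lies in a translate with a countable network, and regularity comes from
    \<open>X\<close>.\<close>
  have cosmic: "cosmic_space (subtopology X U)" if U: "U \<in> \<U>" for U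
  proof -
    obtain x where "x \<in> topspace X" "U \<subseteq> mul x ` H"
      using \<U>(3) U unfolding cover_refines_def by blast
    then show ?thesis
      using cosmic_space_subtopology[OF assms(2) net_translate] by blast
  qed
  moreover have "topological_sum_of_subspaces X \<U>"
    using \<U>(1,2) by (rule topological_sum_open_partition)
  moreover have "submetrizable_space X"
    using \<U>(1,2) cosmic by (rule submetrizable_cosmic_partition)
  moreover have "strongly_paracompact_space X"
  proof (rule strongly_paracompact_open_partition[OF \<U>(1,2)])
    show "strongly_paracompact_space (subtopology X U)" if "U \<in> \<U>" for U
      using cosmic[OF that] has_countable_network_imp_Lindelof
      by (intro strongly_paracompact_regular_Lindelof) (auto simp: cosmic_space_iff)
  qed
  ultimately show ?thesis
    by blast
qed

end
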